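(* Let $\mathcal{Q}$ be a node query. The following are equivalent: (1) $\mathcal{Q}$ is expressed by a key-invariant LocalMax GNN with continuous combination functions that never outputs $0$ on keyed graphs; (2) both $\mathcal{Q}$ and $\mathcal{Q}^c$ are expressed by key-invariant LocalMax GNNs with continuous combination functions; (3) $\mathcal{Q}$ is expressed by a key-oblivious LocalMax GNN whose combination functions are ReLU feedforward networks; (4) $\mathcal{Q}$ is expressible in modal logic.
   Context: Fix a finite set $\Pi=\{p_1,\dots,p_n\}$ of propositions. A graph is $G=(V,E,\mathrm{lab})$ with $V$ finite, $E\subseteq V\times V$ irreflexive and symmetric, $\mathrm{lab}:V\to\{0,1\}^n$. A pointed graph $G^u$ has a distinguished node $u$; a node query is a class of pointed graphs closed under isomorphism (preserving labels, edges both ways and distinguished node); $\mathcal{Q}^c$ is its complement. A keyed extension adds an injective $\mathrm{key}:V\to\mathbb{R}$. A GNN is a sequence of layers $(\mathrm{agg}_i,\mathrm{com}_i)_{i=1}^\ell$ with $\mathrm{com}_i:\mathbb{R}^{2D_i}\to\mathbb{R}^{D_{i+1}}$, $D_{\ell+1}=1$; each layer computes $\mathrm{emb}'(u)=\mathrm{com}_i(\mathrm{emb}(u),\mathrm{agg}_i(\{\!\{\mathrm{emb}(v)\mid(u,v)\in E\}\!\}))$, and the output is the final value at the distinguished node. LocalMax: every $\mathrm{agg}_i$ is coordinate-wise maximum (empty maximum $=0$). Key-invariant GNNs run on keyed graphs with initial embedding $\mathrm{lab}(v)\oplus(\mathrm{key}(v))$, accept iff output $>0$, are key-invariant if each pointed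 graph has all or none of its keyed extensions accepted, and then express the query of pointed graphs whose keyed extensions are accepted. Key-oblivious GNNs run on unkeyed graphs with initial embedding $\mathrm{lab}(v)$ and express the query of pointed graphs with output $>0$. A ReLU feedforward network is a composition of affine maps with rational coefficients and coordinate-wise $\mathrm{ReLU}(x)=\max(x,0)$. Modal logic: formulas $\phi::=p\mid\top\mid\phi\wedge\psi\mid\neg\phi\mid\Diamond\phi$ ($p\in\Pi$), with $G^u\models p_i$ iff $\mathrm{lab}(u)_i=1$, Boolean connectives standard, and $G^u\models\Diamond\phi$ iff some neighbor $v$ of $u$ has $G^v\models\phi$. $\mathcal{Q}$ is expressible in modal logic if $\mathcal{Q}=\{G^u\mid G^u\models\phi\}$ for some formula $\phi$. *)

theory Defs
  imports
    "HOL-Analysis.Analysis"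
    "HOL-Library.Multiset"
    "HOL-Library.Infinite_Typeclass"
begin

text \<open>
  Since the dimensions of the layers of a GNN vary, \<open>\<real>\<^sup>d\<close> is the carrier of the library topology
  \<^const>\<open>Euclidean_space\<close> \<open>d\<close>: the functions \<open>nat \<Rightarrow> real\<close> vanishing from index \<open>d\<close> on.
  Coordinates, and propositions, are numbered from \<open>0\<close>.
\<close>

type_synonym vec = "nat \<Rightarrow> real"

abbreviation Rvec :: "nat \<Rightarrow> vec set" where
  "Rvec d \<equiv> topspace (Euclidean_space d)"

text \<open>Concatenation \<open>x \<oplus> y\<close> of \<open>x \<in> \<real>\<^sup>d\<close> with a further vector \<open>y\<close>.\<close>

definition vconcat :: "nat \<Rightarrow> vec \<Rightarrow> vec \<Rightarrow> vec" where
  "vconcat d x y = (\<lambda>i. if i < d then x i else y (i - d))"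

definition vsingle :: "real \<Rightarrow> vec" where
  "vsingle r = (\<lambda>i. if i = 0 then r else 0)"


subsection \<open>Graphs and node queries\<close>

record 'v lgraph =
  verts :: "'v set"
  edges :: "('v \<times> 'v) set"
  lab :: "'v \<Rightarrow> vec"

definition lgraph :: "nat \<Rightarrow> 'v lgraph \<Rightarrow> bool" where
  "lgraph n G \<longleftrightarrow>
     finite (verts G) \<and> edges G \<subseteq> verts G \<times> verts G \<and> irrefl (edges G) \<and> sym (edges G) \<and>
     (\<forall>v\<in>verts G. lab G v \<in> Rvec n \<and> (\<forall>i<n. lab G v i \<in> {0, 1}))"

definition nbrs :: "'v lgraph \<Rightarrow> 'v \<Rightarrow> 'v set" where
  "nbrs G u = {v. (u, v) \<in> edges G}"

type_synonym 'v pointed = "'v lgraph \<times> 'v"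

definition pointed_graphs :: "nat \<Rightarrow> 'v pointed set" where
  "pointed_graphs n = {(G, u). lgraph n G \<and> u \<in> verts G}"

fun pointed_iso :: "'v pointed \<Rightarrow> 'v pointed \<Rightarrow> bool" where
  "pointed_iso (G, u) (H, w) \<longleftrightarrow>
     (\<exists>f. bij_betw f (verts G) (verts H) \<and> f u = w \<and>
          (\<forall>v\<in>verts G. lab H (f v) = lab G v) \<and>
          (\<forall>v\<in>verts G. \<forall>v'\<in>verts G. (v, v') \<in> edges G \<longleftrightarrow> (f v, f v') \<in> edges H))"

definition node_query :: "nat \<Rightarrow> 'v pointed set \<Rightarrow> bool" where
  "node_query n Q \<longleftrightarrow>
     Q \<subseteq> pointed_graphs n \<and>
     (\<forall>P\<in>Q. \<forall>P'\<in>pointed_graphs n. pointed_iso P P' \<longrightarrow> P' \<in> Q)"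

definition query_compl :: "nat \<Rightarrow> 'v pointed set \<Rightarrow> 'v pointed set" where
  "query_compl n Q = pointed_graphs n - Q"


subsection \<open>Graph neural networks\<close>

record layer =
  din :: nat
  dout :: nat
  agg :: "vec multiset \<Rightarrow> vec"
  com :: "vec \<Rightarrow> vec"

type_synonym gnn = "layer list"

definition wf_layer :: "layer \<Rightarrow> bool" where
  "wf_layer L \<longleftrightarrow>
     (\<forall>M. set_mset M \<subseteq> Rvec (din L) \<longrightarrow> agg L M \<in> Rvec (din L)) \<and>
     com L \<in> Rvec (2 * din L) \<rightarrow> Rvec (dout L)"

text \<open>\<open>wf_gnn d A\<close>: the layers of \<open>A\<close> compose, with input dimension \<open>d\<close> and output dimension \<open>1\<close>.\<close>

fun wf_gnn :: "nat \<Rightarrow> gnn \<Rightarrow> bool" where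
  "wf_gnn d [] \<longleftrightarrow> d = 1"
| "wf_gnn d (L # A) \<longleftrightarrow> din L = d \<and> wf_layer L \<and> wf_gnn (dout L) A"

definition layer_step :: "'v lgraph \<Rightarrow> layer \<Rightarrow> ('v \<Rightarrow> vec) \<Rightarrow> ('v \<Rightarrow> vec)" where
  "layer_step G L emb =
     (\<lambda>u. com L (vconcat (din L) (emb u) (agg L (image_mset emb (mset_set (nbrs G u))))))"

fun run_gnn :: "'v lgraph \<Rightarrow> gnn \<Rightarrow> ('v \<Rightarrow> vec) \<Rightarrow> ('v \<Rightarrow> vec)" where
  "run_gnn G [] emb = emb"
| "run_gnn G (L # A) emb = run_gnn G A (layer_step G L emb)"

definition coord_max :: "vec multiset \<Rightarrow> vec" where
  "coord_max M = (\<lambda>i. if M = {#} then 0 else Max ((\<lambda>x. x i) ` set_mset M))"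

definition local_max :: "gnn \<Rightarrow> bool" where
  "local_max A \<longleftrightarrow> (\<forall>L\<in>set A. agg L = coord_max)"

definition continuous_gnn :: "gnn \<Rightarrow> bool" where
  "continuous_gnn A \<longleftrightarrow>
     (\<forall>L\<in>set A. continuous_map (Euclidean_space (2 * din L)) (Euclidean_space (dout L)) (com L))"

definition affine_fun :: "nat \<Rightarrow> nat \<Rightarrow> (nat \<Rightarrow> nat \<Rightarrow> real) \<Rightarrow> vec \<Rightarrow> vec \<Rightarrow> vec" where
  "affine_fun d e W b = (\<lambda>x i. if i < e then (\<Sum>j<d. W i j * x j) + b i else 0)"

definition relu :: "vec \<Rightarrow> vec" where
  "relu x = (\<lambda>i. max (x i) 0)"

inductive relu_ffn :: "nat \<Rightarrow> nat \<Rightarrow> (vec \<Rightarrow> vec) \<Rightarrow> bool" where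
  affine: "\<lbrakk>\<forall>i<e. \<forall>j<d. W i j \<in> \<rat>; \<forall>i<e. b i \<in> \<rat>\<rbrakk> \<Longrightarrow> relu_ffn d e (affine_fun d e W b)"
| relu: "relu_ffn d d relu"
| comp: "\<lbrakk>relu_ffn d e f; relu_ffn e k g\<rbrakk> \<Longrightarrow> relu_ffn d k (g \<circ> f)"

definition relu_gnn :: "gnn \<Rightarrow> bool" where
  "relu_gnn A \<longleftrightarrow> (\<forall>L\<in>set A. relu_ffn (2 * din L) (dout L) (com L))"


subsection \<open>Key-invariant and key-oblivious GNNs\<close>

definition keyed_extension :: "'v lgraph \<Rightarrow> ('v \<Rightarrow> real) \<Rightarrow> bool" where
  "keyed_extension G key \<longleftrightarrow> inj_on key (verts G)"

definition keyed_output :: "nat \<Rightarrow> gnn \<Rightarrow> 'v lgraph \<Rightarrow> ('v \<Rightarrow> real) \<Rightarrow> 'v \<Rightarrow> real" where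
  "keyed_output n A G key u = run_gnn G A (\<lambda>v. vconcat n (lab G v) (vsingle (key v))) u 0"

definition oblivious_output :: "gnn \<Rightarrow> 'v lgraph \<Rightarrow> 'v \<Rightarrow> real" where
  "oblivious_output A G u = run_gnn G A (lab G) u 0"

text \<open>The type argument names the universe from which the vertices of the graphs are drawn.\<close>

definition key_invariant :: "'v itself \<Rightarrow> nat \<Rightarrow> gnn \<Rightarrow> bool" where
  "key_invariant _ n A \<longleftrightarrow>
     (\<forall>(G, u) \<in> (pointed_graphs n :: 'v pointed set).
        (\<forall>key. keyed_extension G key \<longrightarrow> keyed_output n A G key u > 0) \<or>
        (\<forall>key. keyed_extension G key \<longrightarrow> \<not> keyed_output n A G key u > 0))"

definition never_zero :: "'v itself \<Rightarrow> nat \<Rightarrow> gnn \<Rightarrow> bool" where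
  "never_zero _ n A \<longleftrightarrow>
     (\<forall>(G, u) \<in> (pointed_graphs n :: 'v pointed set).
        \<forall>key. keyed_extension G key \<longrightarrow> keyed_output n A G key u \<noteq> 0)"

definition key_query :: "nat \<Rightarrow> gnn \<Rightarrow> 'v pointed set" where
  "key_query n A =
     {(G, u) \<in> pointed_graphs n. \<forall>key. keyed_extension G key \<longrightarrow> keyed_output n A G key u > 0}"

definition oblivious_query :: "nat \<Rightarrow> gnn \<Rightarrow> 'v pointed set" where
  "oblivious_query n A = {(G, u) \<in> pointed_graphs n. oblivious_output A G u > 0}"

definition expressed_key_invariant :: "nat \<Rightarrow> gnn \<Rightarrow> 'v pointed set \<Rightarrow> bool" where
  "expressed_key_invariant n A Q \<longleftrightarrow>
     wf_gnn (n + 1) A \<and> key_invariant TYPE('v) n A \<and> Q = key_query n A"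

definition expressed_key_oblivious :: "nat \<Rightarrow> gnn \<Rightarrow> 'v pointed set \<Rightarrow> bool" where
  "expressed_key_oblivious n A Q \<longleftrightarrow> wf_gnn n A \<and> Q = oblivious_query n A"

definition key_invariant_LocalMax_expressible :: "nat \<Rightarrow> 'v pointed set \<Rightarrow> bool" where
  "key_invariant_LocalMax_expressible n Q \<longleftrightarrow>
     (\<exists>A. local_max A \<and> continuous_gnn A \<and> expressed_key_invariant n A Q)"

definition nonzero_key_invariant_LocalMax_expressible :: "nat \<Rightarrow> 'v pointed set \<Rightarrow> bool" where
  "nonzero_key_invariant_LocalMax_expressible n Q \<longleftrightarrow>
     (\<exists>A. local_max A \<and> continuous_gnn A \<and> expressed_key_invariant n A Q \<and>
          never_zero TYPE('v) n A)"

definition key_oblivious_ReLU_LocalMax_expressible :: "nat \<Rightarrow> 'v pointed set \<Rightarrow> bool" where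
  "key_oblivious_ReLU_LocalMax_expressible n Q \<longleftrightarrow>
     (\<exists>A. local_max A \<and> relu_gnn A \<and> expressed_key_oblivious n A Q)"


subsection \<open>Modal logic\<close>

datatype (props: 'p) fm = Prop 'p | Top | And "'p fm" "'p fm" | Neg "'p fm" | Dia "'p fm"

fun sat :: "'v lgraph \<Rightarrow> 'v \<Rightarrow> nat fm \<Rightarrow> bool" where
  "sat G u (Prop i) \<longleftrightarrow> lab G u i = 1"
| "sat G u Top \<longleftrightarrow> True"
| "sat G u (And \<phi> \<psi>) \<longleftrightarrow> sat G u \<phi> \<and> sat G u \<psi>"
| "sat G u (Neg \<phi>) \<longleftrightarrow> \<not> sat G u \<phi>"
| "sat G u (Dia \<phi>) \<longleftrightarrow> (\<exists>v\<in>nbrs G u. sat G v \<phi>)"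

definition modal_expressible :: "nat \<Rightarrow> 'v pointed set \<Rightarrow> bool" where
  "modal_expressible n Q \<longleftrightarrow>
     (\<exists>\<phi>. props \<phi> \<subseteq> {..<n} \<and> Q = {(G, u) \<in> pointed_graphs n. sat G u \<phi>})"

end

theory Submission
  imports Defs
begin

text \<open>
  The heart of the matter is that a query expressed, together with its complement, by key-invariant
  continuous LocalMax networks with at most \<open>l\<close> layers is invariant under \<open>l\<close>-bisimilarity. Two
  \<open>l\<close>-bisimilar pointed graphs have a common graded cover, whose vertices are the triples
  \<open>(g, h, i)\<close> with \<open>i \<le> l\<close> and \<open>g\<close>, \<open>h\<close> being \<open>(l - i)\<close>-bisimilar. A maximum ignores
  multiplicities, so with keys pulled back from either graph the cover has the same output as that
  graph; if this output is positive, continuity keeps it positive for nearby injective keys. Hence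
  acceptance by either network passes to the cover, and the cover cannot lie in both the query and
  its complement. A query invariant under \<open>l\<close>-bisimilarity is modal, since finitely many formulas
  determine the \<open>l\<close>-bisimilarity class. Conversely a formula is compiled into a network one
  connective per layer, the maximum over neighbours of \<open>0/1\<close> truth values being the diamond.
\<close>

subsection \<open>Continuity of layers\<close>

lemma Rvec_eq: "Rvec d = {x. \<forall>i\<ge>d. x i = 0}"
  by (simp add: topspace_Euclidean_space)

text \<open>\<open>Euclidean_space d\<close> is a subspace of a product topology, so continuity into
  it splits into continuity of each coordinate and landing in the subspace. All later continuity
  proofs use this form.\<close>

lemma continuous_map_into_Euclidean_space_iff:
  "continuous_map X (Euclidean_space d) f \<longleftrightarrow>
     (\<forall>i. continuous_map X euclideanreal (\<lambda>x. f x i)) \<and> f \<in> topspace X \<rightarrow> Rvec d"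
  unfolding Rvec_eq
  by (auto simp: Euclidean_space_def continuous_map_in_subtopology continuous_map_componentwise_UNIV
      Pi_iff image_subset_iff)

lemma continuous_map_Euclidean_coordinate:
  "continuous_map (Euclidean_space d) euclideanreal (\<lambda>x. x i)"
  using continuous_map_into_Euclidean_space_iff[of "Euclidean_space d" d "\<lambda>x. x"]
    continuous_map_id[of "Euclidean_space d"] by (simp add: id_def)

lemma continuous_map_Max:
  fixes g :: "'b \<Rightarrow> 'a \<Rightarrow> real"
  assumes "finite S" "S \<noteq> {}" "\<And>v. v \<in> S \<Longrightarrow> continuous_map X euclideanreal (g v)"
  shows "continuous_map X euclideanreal (\<lambda>x. Max ((\<lambda>v. g v x) ` S))"
  using assms
proof (induction S rule: finite_ne_induct)
  case (insert v S)
  then show ?case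
    by (simp add: continuous_map_real_max)
qed simp

lemma relu_ffn_continuous:
  "relu_ffn d e f \<Longrightarrow> continuous_map (Euclidean_space d) (Euclidean_space e) f"
proof (induction rule: relu_ffn.induct)
  case (affine e d W b)
  show ?case
    unfolding continuous_map_into_Euclidean_space_iff affine_fun_def
  proof (intro conjI allI)
    fix i
    show "continuous_map (Euclidean_space d) euclideanreal
            (\<lambda>x. if i < e then (\<Sum>j<d. W i j * x j) + b i else 0)"
      by (cases "i < e")
        (auto intro!: continuous_map_add continuous_map_sum continuous_map_real_mult_left
          continuous_map_Euclidean_coordinate)
  qed (auto simp: Rvec_eq)
next
  case (relu d)
  show ?case
    unfolding continuous_map_into_Euclidean_space_iff relu_def
    by (auto simp: Rvec_eq intro!: continuous_map_real_max continuous_map_Euclidean_coordinate)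
next
  case (comp d e f k g)
  then show ?case by (blast intro: continuous_map_compose)
qed

lemma relu_gnn_continuous: "relu_gnn A \<Longrightarrow> continuous_gnn A"
  by (simp add: relu_gnn_def continuous_gnn_def relu_ffn_continuous)

lemma coord_max_in_Rvec: "set_mset M \<subseteq> Rvec d \<Longrightarrow> coord_max M \<in> Rvec d"
proof (cases "M = {#}")
  case False
  moreover assume M: "set_mset M \<subseteq> Rvec d"
  moreover have "(\<lambda>x. x i) ` set_mset M = {0}" if "d \<le> i" for i
  proof -
    have "\<forall>x\<in>set_mset M. x i = 0" using M that by (auto simp: Rvec_eq)
    then show ?thesis using multiset_nonemptyE[OF False] by (force simp: image_iff)
  qed
  ultimately show ?thesis
    by (simp add: Rvec_eq coord_max_def)
qed (simp add: Rvec_eq coord_max_def)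

lemma wf_layer_relu:
  assumes "agg L = coord_max" "relu_ffn (2 * din L) (dout L) (com L)"
  shows "wf_layer L"
  using assms relu_ffn_continuous[OF assms(2)]
  by (simp add: wf_layer_def coord_max_in_Rvec continuous_map_into_Euclidean_space_iff)

lemma coord_max_image_mset_set:
  assumes "finite S"
  shows "coord_max (image_mset emb (mset_set S)) i =
           (if S = {} then 0 else Max ((\<lambda>v. emb v i) ` S))"
  using assms by (auto simp: coord_max_def image_image mset_set_empty_iff)

lemma lgraph_nbrs: "lgraph n G \<Longrightarrow> nbrs G v \<subseteq> verts G \<and> finite (nbrs G v)"
  by (auto simp: lgraph_def nbrs_def intro: finite_subset)

text \<open>Only the embedding varies with the parameter while the graph stays fixed. Hence the
  aggregate is a maximum over a fixed finite set of neighbours, or constantly \<open>0\<close> at an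
  isolated node.\<close>

lemma layer_step_continuous:
  assumes "lgraph n G" "u \<in> verts G" "agg L = coord_max"
    and com: "continuous_map (Euclidean_space (2 * din L)) (Euclidean_space (dout L)) (com L)"
    and emb: "\<And>v. v \<in> verts G \<Longrightarrow> continuous_map X (Euclidean_space (din L)) (\<lambda>t. emb t v)"
  shows "continuous_map X (Euclidean_space (dout L)) (\<lambda>t. layer_step G L (emb t) u)"
proof -
  note N = lgraph_nbrs[OF assms(1), of u]
  have coord: "continuous_map X euclideanreal (\<lambda>t. emb t v i)" if "v \<in> verts G" for v i
    using emb[OF that] by (simp add: continuous_map_into_Euclidean_space_iff)
  have zero: "emb t v i = 0" if "v \<in> verts G" "t \<in> topspace X" "din L \<le> i" for t v i
    using emb[OF that(1)] that by (auto simp: continuous_map_into_Euclidean_space_iff Rvec_eq)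
  have agg_cont: "continuous_map X euclideanreal
          (\<lambda>t. coord_max (image_mset (emb t) (mset_set (nbrs G u))) i)" for i
    using N by (auto simp: coord_max_image_mset_set intro!: continuous_map_Max coord)
  have agg_in: "coord_max (image_mset (emb t) (mset_set (nbrs G u))) \<in> Rvec (din L)"
    if "t \<in> topspace X" for t
    using N zero that by (intro coord_max_in_Rvec) (auto simp: Rvec_eq)
  have "continuous_map X (Euclidean_space (2 * din L))
          (\<lambda>t. vconcat (din L) (emb t u) (coord_max (image_mset (emb t) (mset_set (nbrs G u)))))"
    unfolding continuous_map_into_Euclidean_space_iff
  proof (intro conjI allI)
    fix i
    show "continuous_map X euclideanreal (\<lambda>t. vconcat (din L) (emb t u)
            (coord_max (image_mset (emb t) (mset_set (nbrs G u)))) i)"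
      using coord[OF assms(2)] agg_cont by (cases "i < din L") (simp_all add: vconcat_def)
  next
    show "(\<lambda>t. vconcat (din L) (emb t u) (coord_max (image_mset (emb t) (mset_set (nbrs G u)))))
            \<in> topspace X \<rightarrow> Rvec (2 * din L)"
      using agg_in by (auto simp: Rvec_eq vconcat_def)
  qed
  from continuous_map_compose[OF this com] show ?thesis
    by (simp add: layer_step_def assms(3) o_def)
qed

lemma run_gnn_continuous:
  assumes "lgraph n G" "local_max A" "continuous_gnn A" "wf_gnn d A" "u \<in> verts G"
    and "\<And>v. v \<in> verts G \<Longrightarrow> continuous_map X (Euclidean_space d) (\<lambda>t. emb t v)"
  shows "continuous_map X (Euclidean_space 1) (\<lambda>t. run_gnn G A (emb t) u)"
  using assms(2-)
proof (induction A arbitrary: d emb)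
  case (Cons L A)
  have "continuous_map X (Euclidean_space (dout L)) (\<lambda>t. layer_step G L (emb t) v)"
    if "v \<in> verts G" for v
    using Cons.prems that
    by (intro layer_step_continuous[OF assms(1)]) (auto simp: local_max_def continuous_gnn_def)
  with Cons show ?case
    by (auto simp: local_max_def continuous_gnn_def)
qed simp


subsection \<open>Graded bisimulation\<close>

lemma coord_max_cong:
  assumes "set_mset M = set_mset N"
  shows "coord_max M = coord_max N"
  using assms by (auto simp: coord_max_def fun_eq_iff)

text \<open>A maximum depends only on the set of neighbouring values, and the back and forth
  conditions make these sets equal. The index of \<open>R\<close> counts the layers that may still
  be run, each layer consuming one. \<open>R\<close> is left abstract so as to cover both
  \<open>bisim\<close> and the projection of a graded cover.\<close>

lemma run_gnn_graded_bisimulation: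
  assumes "local_max A" "\<And>v. finite (nbrs G v)" "\<And>w. finite (nbrs H w)"
    and "\<And>k v w. R k v w \<Longrightarrow> emb v = emb' w"
    and "\<And>k v w v'. \<lbrakk>R (Suc k) v w; v' \<in> nbrs G v\<rbrakk> \<Longrightarrow> \<exists>w'\<in>nbrs H w. R k v' w'"
    and "\<And>k v w w'. \<lbrakk>R (Suc k) v w; w' \<in> nbrs H w\<rbrakk> \<Longrightarrow> \<exists>v'\<in>nbrs G v. R k v' w'"
    and "R (length A) v w"
  shows "run_gnn G A emb v = run_gnn H A emb' w"
  using assms
proof (induction A arbitrary: R emb emb')
  case (Cons L A)
  have "layer_step G L emb v = layer_step H L emb' w" if R: "R (Suc k) v w" for k v w
  proof -
    have "emb ` nbrs G v \<subseteq> emb' ` nbrs H w"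
    proof
      fix y assume "y \<in> emb ` nbrs G v"
      then obtain v' where "v' \<in> nbrs G v" "y = emb v'" by blast
      with Cons.prems(5)[OF R] Cons.prems(4) show "y \<in> emb' ` nbrs H w"
        by (metis imageI)
    qed
    moreover have "emb' ` nbrs H w \<subseteq> emb ` nbrs G v"
    proof
      fix y assume "y \<in> emb' ` nbrs H w"
      then obtain w' where "w' \<in> nbrs H w" "y = emb' w'" by blast
      with Cons.prems(6)[OF R] Cons.prems(4) show "y \<in> emb ` nbrs G v"
        by (metis imageI)
    qed
    ultimately have "set_mset (image_mset emb (mset_set (nbrs G v))) =
        set_mset (image_mset emb' (mset_set (nbrs H w)))"
      using Cons.prems(2,3) by auto
    from coord_max_cong[OF this] show ?thesis
      using Cons.prems(1) Cons.prems(4)[OF R] by (simp add: layer_step_def local_max_def)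
  qed
  \<comment> \<open>After one layer the values agree only on pairs related at a successor index, so
    the induction continues with the shifted relation.\<close>
  then have "run_gnn G A (layer_step G L emb) v = run_gnn H A (layer_step H L emb') w"
    using Cons.prems by (intro Cons.IH[of "\<lambda>k. R (Suc k)"]) (auto simp: local_max_def)
  then show ?case by simp
next
  case Nil
  then show ?case by auto
qed

fun bisim :: "nat \<Rightarrow> 'v lgraph \<Rightarrow> 'v \<Rightarrow> 'w lgraph \<Rightarrow> 'w \<Rightarrow> bool" where
  "bisim 0 G u H w \<longleftrightarrow> lab G u = lab H w"
| "bisim (Suc k) G u H w \<longleftrightarrow> lab G u = lab H w \<and>
     (\<forall>u'\<in>nbrs G u. \<exists>w'\<in>nbrs H w. bisim k G u' H w') \<and>
     (\<forall>w'\<in>nbrs H w. \<exists>u'\<in>nbrs G u. bisim k G u' H w')"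

lemma bisim_lab: "bisim k G u H w \<Longrightarrow> lab G u = lab H w"
  by (cases k) auto

lemma oblivious_output_bisim:
  assumes "local_max A" "lgraph n G" "lgraph n H" "bisim (length A) G u H w"
  shows "oblivious_output A G u = oblivious_output A H w"
proof -
  have "run_gnn G A (lab G) u = run_gnn H A (lab H) w"
    using assms
    by (intro run_gnn_graded_bisimulation[where R = "\<lambda>k u w. bisim k G u H w"])
      (auto simp: lgraph_nbrs bisim_lab)
  then show ?thesis by (simp add: oblivious_output_def)
qed


subsection \<open>Definability of bisimulation-invariant queries\<close>

lemma big_conjunction:
  fixes F :: "nat fm set"
  assumes "finite F" "\<forall>\<psi>\<in>F. props \<psi> \<subseteq> S"
  shows "\<exists>\<phi>. props \<phi> \<subseteq> S \<and>
           (\<forall>(G :: 'v lgraph) u. sat G u \<phi> \<longleftrightarrow> (\<forall>\<psi>\<in>F. sat G u \<psi>))"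
  using assms
proof (induction F rule: finite_induct)
  case empty
  show ?case by (rule exI[of _ Top]) simp
next
  case (insert \<psi> F)
  then obtain \<phi> where "props \<phi> \<subseteq> S"
    "\<forall>(G :: 'v lgraph) u. sat G u \<phi> \<longleftrightarrow> (\<forall>\<psi>\<in>F. sat G u \<psi>)" by auto
  with insert show ?case by (intro exI[of _ "And \<psi> \<phi>"]) auto
qed

text \<open>This is the type of \<open>u\<close> in the model-theoretic sense, restricted to the
  formulas in \<open>F\<close>.\<close>

definition diagram :: "nat fm set \<Rightarrow> 'v lgraph \<Rightarrow> 'v \<Rightarrow> nat fm set" where
  "diagram F G u = {\<psi> \<in> F. sat G u \<psi>}"

text \<open>Conjoin the members of \<open>D\<close> with the negations of the members of
  \<open>F - D\<close>. A set \<open>D\<close> not contained in \<open>F\<close> is no node's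
  diagram, so a contradiction defines it.\<close>

lemma diagram_formula:
  fixes F :: "nat fm set"
  assumes "finite F" "\<forall>\<psi>\<in>F. props \<psi> \<subseteq> S"
  shows "\<exists>\<phi>. props \<phi> \<subseteq> S \<and> (\<forall>(G :: 'v lgraph) u. sat G u \<phi> \<longleftrightarrow> diagram F G u = D)"
proof (cases "D \<subseteq> F")
  case True
  let ?L = "D \<union> Neg ` (F - D)"
  have "finite ?L" "\<forall>\<psi>\<in>?L. props \<psi> \<subseteq> S"
    using assms True finite_subset[OF True assms(1)] by fastforce+
  then have "\<exists>\<phi>. props \<phi> \<subseteq> S \<and>
      (\<forall>(G :: 'v lgraph) u. sat G u \<phi> \<longleftrightarrow> (\<forall>\<psi>\<in>?L. sat G u \<psi>))"
    by (rule big_conjunction)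
  moreover have "(\<forall>\<psi>\<in>?L. sat G u \<psi>) \<longleftrightarrow> diagram F G u = D" for G :: "'v lgraph" and u
    using True unfolding ball_Un ball_simps by (auto simp: diagram_def)
  ultimately show ?thesis by simp
next
  case False
  then show ?thesis
    by (intro exI[of _ "Neg Top"]) (auto simp: diagram_def)
qed

text \<open>At depth \<open>0\<close> the propositions suffice, because labels are
  \<open>0/1\<close> below \<open>n\<close> and vanish from \<open>n\<close> on. One level deeper,
  it suffices to record which of the finitely many \<open>F\<close>-diagrams occur among the
  neighbours.\<close>

lemma bisim_of_diagrams:
  "\<exists>F. finite F \<and> (\<forall>\<psi>\<in>F. props \<psi> \<subseteq> {..<n}) \<and>
     (\<forall>(G :: 'v lgraph) u (H :: 'v lgraph) w. (G, u) \<in> pointed_graphs n \<longrightarrow>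
        (H, w) \<in> pointed_graphs n \<longrightarrow> diagram F G u = diagram F H w \<longrightarrow> bisim k G u H w)"
proof (induction k)
  case 0
  have "lab G u = lab H w"
    if "(G, u) \<in> pointed_graphs n" "(H, w) \<in> pointed_graphs n"
      "diagram (Prop ` {..<n}) G u = diagram (Prop ` {..<n}) H w"
    for G H :: "'v lgraph" and u w
  proof
    fix i
    show "lab G u i = lab H w i"
    proof (cases "i < n")
      case True
      then have "lab G u i \<in> {0, 1}" "lab H w i \<in> {0, 1}"
        using that(1,2) by (auto simp: pointed_graphs_def lgraph_def)
      moreover have "Prop i \<in> diagram (Prop ` {..<n}) G u \<longleftrightarrow> lab G u i = 1"
        "Prop i \<in> diagram (Prop ` {..<n}) H w \<longleftrightarrow> lab H w i = 1"
        using True by (auto simp: diagram_def)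
      ultimately show ?thesis using that(3) by auto
    next
      case False
      then show ?thesis
        using that(1,2) by (auto simp: pointed_graphs_def lgraph_def Rvec_eq)
    qed
  qed
  moreover have "finite (Prop ` {..<n})" "\<forall>\<psi>\<in>Prop ` {..<n}. props \<psi> \<subseteq> {..<n}" by auto
  ultimately show ?case
    unfolding bisim.simps by (intro exI[of _ "Prop ` {..<n}"] conjI allI impI)
next
  case (Suc k)
  then obtain F where F: "finite F" "\<forall>\<psi>\<in>F. props \<psi> \<subseteq> {..<n}"
    "\<And>(G :: 'v lgraph) u (H :: 'v lgraph) w. (G, u) \<in> pointed_graphs n \<Longrightarrow>
        (H, w) \<in> pointed_graphs n \<Longrightarrow> diagram F G u = diagram F H w \<Longrightarrow> bisim k G u H w"
    by blast
  have "\<forall>D. \<exists>\<phi>. props \<phi> \<subseteq> {..<n} \<and> (\<forall>(G :: 'v lgraph) u. sat G u \<phi> \<longleftrightarrow> diagram F G u = D)"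
    using diagram_formula[OF F(1,2)] by blast
  then obtain \<theta> where \<theta>: "\<And>D. props (\<theta> D) \<subseteq> {..<n}"
    "\<And>D (G :: 'v lgraph) u. sat G u (\<theta> D) \<longleftrightarrow> diagram F G u = D" by metis
  define F' where "F' = F \<union> (\<lambda>D. Dia (\<theta> D)) ` Pow F \<union> Prop ` {..<n}"
  have fin: "finite F'" "\<forall>\<psi>\<in>F'. props \<psi> \<subseteq> {..<n}"
    using F(1,2) \<theta>(1) unfolding F'_def by (simp, fastforce)
  \<comment> \<open>Stated for arbitrary \<open>G\<close> and \<open>H\<close>, this gives the forth
    condition directly and the back condition after exchanging the two graphs.\<close>
  have half: "\<exists>w'\<in>nbrs H w. diagram F H w' = diagram F G u'"
    if "diagram F' G u = diagram F' H w" "u' \<in> nbrs G u" for G H :: "'v lgraph" and u w u'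
  proof -
    let ?\<delta> = "Dia (\<theta> (diagram F G u'))"
    have "?\<delta> \<in> F'" by (auto simp: F'_def diagram_def)
    moreover have "sat G u ?\<delta>" using that(2) \<theta>(2) by auto
    ultimately have "?\<delta> \<in> diagram F' G u" unfolding diagram_def by blast
    then have "sat H w ?\<delta>" unfolding that(1) by (simp add: diagram_def)
    then show ?thesis using \<theta>(2) by auto
  qed
  have "bisim (Suc k) G u H w"
    if PG: "(G, u) \<in> pointed_graphs n" and PH: "(H, w) \<in> pointed_graphs n"
      and eq: "diagram F' G u = diagram F' H w" for G H :: "'v lgraph" and u w
  proof -
    have pt: "(G, u') \<in> pointed_graphs n" "(H, w') \<in> pointed_graphs n"
      if "u' \<in> verts G" "w' \<in> verts H" for u' w'
      using PG PH that by (auto simp: pointed_graphs_def)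
    have sub: "nbrs G u \<subseteq> verts G" "nbrs H w \<subseteq> verts H"
      using PG PH lgraph_nbrs[of n G] lgraph_nbrs[of n H] by (auto simp: pointed_graphs_def)
    \<comment> \<open>Agreement on \<open>F'\<close> restricts to agreement on \<open>F\<close>; the
      induction hypothesis then yields equal labels.\<close>
    have "diagram F G u = diagram F' G u \<inter> F" "diagram F H w = diagram F' H w \<inter> F"
      by (auto simp: diagram_def F'_def)
    then have "lab G u = lab H w" using F(3)[OF PG PH] eq bisim_lab by simp
    have nbr: "bisim k G u' H w'"
      if "u' \<in> nbrs G u" "w' \<in> nbrs H w" "diagram F G u' = diagram F H w'" for u' w'
      using that sub by (intro F(3) pt[of u' w']) auto
    have "\<exists>w'\<in>nbrs H w. bisim k G u' H w'" if "u' \<in> nbrs G u" for u'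
      using half[OF eq that] nbr[OF that] by auto
    moreover have "\<exists>u'\<in>nbrs G u. bisim k G u' H w'" if "w' \<in> nbrs H w" for w'
      using half[OF eq[symmetric] that] nbr[OF _ that] by auto
    ultimately show ?thesis using \<open>lab G u = lab H w\<close> by simp
  qed
  with fin show ?case by blast
qed

text \<open>Membership in \<open>Q\<close> depends only on the diagram over a suitable finite
  \<open>F\<close>, so \<open>Q\<close> is defined by the finite disjunction of the diagrams
  realised in it.\<close>

lemma modal_expressible_of_bisim_invariant:
  fixes Q :: "'v pointed set"
  assumes Q: "Q \<subseteq> pointed_graphs n"
    and inv: "\<And>G u H w. \<lbrakk>(G, u) \<in> Q; (H, w) \<in> pointed_graphs n; bisim k G u H w\<rbrakk> \<Longrightarrow> (H, w) \<in> Q"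
  shows "modal_expressible n Q"
proof -
  obtain F where F: "finite F" "\<forall>\<psi>\<in>F. props \<psi> \<subseteq> {..<n}"
    "\<And>(G :: 'v lgraph) u (H :: 'v lgraph) w. (G, u) \<in> pointed_graphs n \<Longrightarrow>
        (H, w) \<in> pointed_graphs n \<Longrightarrow> diagram F G u = diagram F H w \<Longrightarrow> bisim k G u H w"
    using bisim_of_diagrams[where 'v = 'v] by metis
  have "\<forall>D. \<exists>\<phi>. props \<phi> \<subseteq> {..<n} \<and> (\<forall>(G :: 'v lgraph) u. sat G u \<phi> \<longleftrightarrow> diagram F G u = D)"
    using diagram_formula[OF F(1,2)] by blast
  then obtain \<theta> where \<theta>: "\<And>D. props (\<theta> D) \<subseteq> {..<n}"
    "\<And>D (G :: 'v lgraph) u. sat G u (\<theta> D) \<longleftrightarrow> diagram F G u = D" by metis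
  let ?D = "(\<lambda>(G, u). diagram F G u) ` Q"
  have "?D \<subseteq> Pow F" by (auto simp: diagram_def)
  then have "finite ((\<lambda>D. Neg (\<theta> D)) ` ?D)" using F(1) finite_subset by blast
  moreover have "\<forall>\<psi>\<in>(\<lambda>D. Neg (\<theta> D)) ` ?D. props \<psi> \<subseteq> {..<n}" using \<theta>(1) by auto
  ultimately have "\<exists>\<phi>. props \<phi> \<subseteq> {..<n} \<and>
    (\<forall>(G :: 'v lgraph) u. sat G u \<phi> \<longleftrightarrow> (\<forall>\<psi>\<in>(\<lambda>D. Neg (\<theta> D)) ` ?D. sat G u \<psi>))"
    by (rule big_conjunction)
  \<comment> \<open>\<open>\<phi>\<close> denies every diagram realised in \<open>Q\<close>; its
    negation is the desired disjunction by De Morgan.\<close>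
  then obtain \<phi> where \<phi>: "props \<phi> \<subseteq> {..<n}"
    "\<And>(G :: 'v lgraph) u. sat G u \<phi> \<longleftrightarrow> (\<forall>\<psi>\<in>(\<lambda>D. Neg (\<theta> D)) ` ?D. sat G u \<psi>)"
    by blast
  have sat_iff: "sat H w (Neg \<phi>) \<longleftrightarrow> (\<exists>G u. (G, u) \<in> Q \<and> diagram F H w = diagram F G u)"
    for H :: "'v lgraph" and w
    by (auto simp: \<phi>(2) \<theta>(2))
  have "Q = {(H, w) \<in> pointed_graphs n. sat H w (Neg \<phi>)}"
  proof (intro subset_antisym subsetI)
    fix P assume "P \<in> Q"
    then show "P \<in> {(H, w) \<in> pointed_graphs n. sat H w (Neg \<phi>)}"
      using Q unfolding sat_iff by auto
  next
    fix P :: "'v pointed" assume "P \<in> {(H, w) \<in> pointed_graphs n. sat H w (Neg \<phi>)}"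
    then obtain H w G u where "P = (H, w)" "(H, w) \<in> pointed_graphs n" "(G, u) \<in> Q"
      "diagram F H w = diagram F G u"
      unfolding sat_iff by auto
    then show "P \<in> Q" using inv[of G u H w] F(3)[of G u H w] Q by auto
  qed
  with \<phi>(1) show ?thesis
    unfolding modal_expressible_def by (intro exI[of _ "Neg \<phi>"]) simp
qed


subsection \<open>Graded covers and perturbation of keys\<close>

text \<open>
  Vertex \<open>x\<close> of the cover \<open>P\<close> sees the same unravelling as \<open>\<pi> x\<close>, but only to depth \<open>l - d x\<close>.
\<close>

definition graded_cover ::
    "nat \<Rightarrow> 'a lgraph \<Rightarrow> ('a \<Rightarrow> 'b) \<Rightarrow> ('a \<Rightarrow> nat) \<Rightarrow> 'b lgraph \<Rightarrow> bool" where
  "graded_cover l P \<pi> d G \<longleftrightarrow>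
     (\<forall>x\<in>verts P. lab P x = lab G (\<pi> x)) \<and>
     (\<forall>x\<in>verts P. \<forall>y\<in>nbrs P x. \<pi> y \<in> nbrs G (\<pi> x) \<and> d y \<le> Suc (d x)) \<and>
     (\<forall>x\<in>verts P. d x < l \<longrightarrow> (\<forall>v\<in>nbrs G (\<pi> x). \<exists>y\<in>nbrs P x. \<pi> y = v))"

lemma keyed_output_graded_cover:
  assumes "local_max A" "lgraph n P" "lgraph n G" "graded_cover l P \<pi> d G"
    and "p \<in> verts P" "d p + length A \<le> l"
  shows "keyed_output n A P (key \<circ> \<pi>) p = keyed_output n A G key (\<pi> p)"
proof -
  \<comment> \<open>With \<open>k\<close> layers left, the cover must be faithful for
    \<open>k\<close> further steps from \<open>x\<close>. At a successor index this forces
    \<open>d x < l\<close>, which is exactly where neighbours can be lifted.\<close>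
  let ?R = "\<lambda>k x v. x \<in> verts P \<and> \<pi> x = v \<and> k + d x \<le> l"
  have sub: "nbrs P x \<subseteq> verts P" for x
    using lgraph_nbrs[OF assms(2)] by blast
  have "run_gnn P A (\<lambda>v. vconcat n (lab P v) (vsingle ((key \<circ> \<pi>) v))) p =
        run_gnn G A (\<lambda>v. vconcat n (lab G v) (vsingle (key v))) (\<pi> p)"
  proof (rule run_gnn_graded_bisimulation[where R = ?R])
    fix k x v v' assume "?R (Suc k) x v" "v' \<in> nbrs G v"
    moreover from this obtain y where "y \<in> nbrs P x" "\<pi> y = v'"
      using assms(4) unfolding graded_cover_def
      by (metis add_Suc le_add2 less_eq_Suc_le order_trans Suc_le_mono)
    moreover from calculation have "d y \<le> Suc (d x)"
      using assms(4) unfolding graded_cover_def by blast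
    ultimately show "\<exists>y\<in>nbrs P x. ?R k y v'"
      using sub by (intro bexI[of _ y]) auto
  next
    fix k x v y assume "?R (Suc k) x v" "y \<in> nbrs P x"
    moreover from this have "\<pi> y \<in> nbrs G v" "d y \<le> Suc (d x)"
      using assms(4) unfolding graded_cover_def by blast+
    ultimately show "\<exists>v'\<in>nbrs G v. ?R k y v'"
      using sub by auto
  qed (use assms in \<open>auto simp: graded_cover_def lgraph_nbrs[OF assms(2)] lgraph_nbrs[OF assms(3)]\<close>)
  then show ?thesis by (simp add: keyed_output_def)
qed

lemma exists_injective_key:
  assumes "finite S"
  shows "\<exists>key :: 'v \<Rightarrow> real. inj_on key S"
proof -
  obtain f :: "'v \<Rightarrow> nat" where "inj_on f S"
    using finite_imp_inj_to_nat_seg[OF assms] by blast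
  then have "inj_on (\<lambda>v. real (f v)) S" by (simp add: inj_on_def)
  then show ?thesis by blast
qed

text \<open>As \<open>c\<close> is injective, two distinct points collide for at most one
  \<open>t\<close>. Finitely many values are thus excluded from an infinite interval.\<close>

lemma injective_perturbation:
  fixes k c :: "'v \<Rightarrow> real"
  assumes "finite S" "inj_on c S" "0 < e"
  obtains t where "\<bar>t\<bar> < e" "inj_on (\<lambda>v. k v + t * c v) S"
proof -
  \<comment> \<open>These are the collision times. Diagonal pairs contribute only \<open>0\<close>,
    by the convention for division by zero, and \<open>0\<close> lies outside the interval.\<close>
  let ?B = "(\<lambda>(x, y). (k y - k x) / (c x - c y)) ` (S \<times> S)"
  have "infinite ({0<..<e} - ?B)"
    using assms by (intro Diff_infinite_finite) auto
  then obtain t where t: "t \<in> {0<..<e}" "t \<notin> ?B"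
    using infinite_imp_nonempty by blast
  have "inj_on (\<lambda>v. k v + t * c v) S"
  proof (rule inj_onI, rule ccontr)
    fix x y assume xy: "x \<in> S" "y \<in> S" "k x + t * c x = k y + t * c y" "x \<noteq> y"
    then have "c x \<noteq> c y" using assms(2) by (auto dest: inj_onD)
    with xy(3) have "t = (k y - k x) / (c x - c y)" by (simp add: field_simps)
    with t(2) xy(1,2) show False by (auto simp: image_iff)
  qed
  with t that[of t] show ?thesis by auto
qed

text \<open>
  The keys pulled back along a cover are not injective, but acceptance is an open condition, so it
  survives a small perturbation that makes them injective.
\<close>

lemma key_query_graded_cover:
  fixes G P :: "'v lgraph"
  assumes A: "local_max A" "continuous_gnn A" "expressed_key_invariant n A Q"
    and P: "(P, p) \<in> pointed_graphs n" and GQ: "(G, \<pi> p) \<in> Q"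
    and cover: "graded_cover l P \<pi> d G" "d p + length A \<le> l"
  shows "(P, p) \<in> Q"
proof -
  have wf: "wf_gnn (n + 1) A" and inv: "key_invariant TYPE('v) n A" and Q: "Q = key_query n A"
    using A(3) by (auto simp: expressed_key_invariant_def)
  have lP: "lgraph n P" "p \<in> verts P" and lG: "lgraph n G"
    using P GQ by (auto simp: pointed_graphs_def Q key_query_def)
  obtain key :: "'v \<Rightarrow> real" where key: "inj_on key (verts G)"
    using exists_injective_key[of "verts G"] lG unfolding lgraph_def by blast
  obtain c :: "'v \<Rightarrow> real" where c: "inj_on c (verts P)"
    using exists_injective_key[of "verts P"] lP unfolding lgraph_def by blast
  \<comment> \<open>At \<open>t = 0\<close> the keys are pulled back from \<open>G\<close>; the
    direction \<open>c\<close> is injective, so small perturbations along it can separate all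
    vertices.\<close>
  define f where "f t = keyed_output n A P (\<lambda>v. key (\<pi> v) + t * c v) p" for t
  have "continuous_map euclideanreal (Euclidean_space (n + 1))
          (\<lambda>t. vconcat n (lab P v) (vsingle (key (\<pi> v) + t * c v)))" if "v \<in> verts P" for v
    unfolding continuous_map_into_Euclidean_space_iff
  proof (intro conjI allI)
    fix i
    show "continuous_map euclideanreal euclideanreal
            (\<lambda>t. vconcat n (lab P v) (vsingle (key (\<pi> v) + t * c v)) i)"
      by (cases "i < n"; cases "i = n")
        (auto simp: vconcat_def vsingle_def intro!: continuous_intros)
  next
    show "(\<lambda>t. vconcat n (lab P v) (vsingle (key (\<pi> v) + t * c v)))
            \<in> topspace euclideanreal \<rightarrow> Rvec (n + 1)"
      by (auto simp: Rvec_eq vconcat_def vsingle_def)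
  qed
  from run_gnn_continuous[OF lP(1) A(1,2) wf lP(2) this]
  have "continuous_on UNIV f"
    by (simp add: continuous_map_into_Euclidean_space_iff f_def keyed_output_def)
  moreover have "f 0 > 0"
  proof -
    have "f 0 = keyed_output n A G key (\<pi> p)"
      using keyed_output_graded_cover[OF A(1) lP(1) lG cover(1) lP(2) cover(2), of key]
      by (simp add: f_def o_def)
    then show ?thesis using GQ key by (simp add: Q key_query_def keyed_extension_def)
  qed
  ultimately obtain e where e: "e > 0" "\<And>t. \<bar>t\<bar> < e \<Longrightarrow> f t > 0"
  proof -
    have "open (f -` {0<..})"
      using \<open>continuous_on UNIV f\<close> by (simp add: open_vimage)
    moreover have "0 \<in> f -` {0<..}" using \<open>f 0 > 0\<close> by simp
    ultimately obtain e where "e > 0" "ball 0 e \<subseteq> f -` {0<..}"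
      unfolding open_contains_ball by blast
    then show ?thesis using that[of e] by (auto simp: subset_iff)
  qed
  obtain t where "\<bar>t\<bar> < e" "inj_on (\<lambda>v. key (\<pi> v) + t * c v) (verts P)"
    using injective_perturbation[of "verts P" c e "key \<circ> \<pi>"] c e(1) lP(1)
    by (auto simp: lgraph_def)
  \<comment> \<open>By key invariance, a single accepted injective key already puts the cover in the
    query.\<close>
  with e(2)[of t] have "\<exists>key. keyed_extension P key \<and> keyed_output n A P key p > 0"
    by (auto simp: f_def keyed_extension_def)
  with inv P show ?thesis
    by (auto simp: key_invariant_def Q key_query_def)
qed

lemma bisim_common_cover:
  fixes G H :: "'v::infinite lgraph"
  assumes G: "(G, u) \<in> pointed_graphs n" and H: "(H, w) \<in> pointed_graphs n"
    and bis: "bisim l G u H w"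
  obtains P :: "'v lgraph" and p \<pi> \<sigma> d
  where "(P, p) \<in> pointed_graphs n" "\<pi> p = u" "\<sigma> p = w" "d p = 0"
    "graded_cover l P \<pi> d G" "graded_cover l P \<sigma> d H"
proof -
  define V where "V = {(g, h, i). g \<in> verts G \<and> h \<in> verts H \<and> i \<le> l \<and> bisim (l - i) G g H h}"
  \<comment> \<open>The level may change by at most one in either direction, which keeps the edges
    undirected. Every edge projects to edges of \<open>G\<close> and \<open>H\<close>, whereas
    lifting will always move one level up.\<close>
  define adj where "adj = (\<lambda>(g, h, i :: nat) (g', h', j).
      g' \<in> nbrs G g \<and> h' \<in> nbrs H h \<and> i \<le> Suc j \<and> j \<le> Suc i)"
  have lG: "lgraph n G" and lH: "lgraph n H" using G H by (auto simp: pointed_graphs_def)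
  have "V \<subseteq> verts G \<times> verts H \<times> {..l}" by (auto simp: V_def)
  moreover have "finite (verts G \<times> verts H \<times> {..l})" using lG lH by (simp add: lgraph_def)
  ultimately have finV: "finite V" by (rule finite_subset)
  \<comment> \<open>The query speaks only of graphs over \<open>'v\<close>, so the triples are
    encoded as elements of this infinite type.\<close>
  obtain B :: "'v set" where "finite B" "card B = card V"
    using infinite_arbitrarily_large[OF infinite_UNIV] by blast
  then obtain e where "bij_betw e V B"
    using finV finite_same_card_bij by metis
  then have inj: "inj_on e V" by (rule bij_betw_imp_inj_on)
  define r where "r = inv_into V e"
  have r: "r (e a) = a" if "a \<in> V" for a
    using inj that by (simp add: r_def)
  define P where "P = \<lparr>verts = e ` V, edges = {(e a, e b) | a b. a \<in> V \<and> b \<in> V \<and> adj a b},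
      lab = (\<lambda>x. lab G (fst (r x)))\<rparr>"
  have nbrsP: "nbrs P (e a) = e ` {b \<in> V. adj a b}" if "a \<in> V" for a
  proof (rule set_eqI)
    fix x
    have "x \<in> nbrs P (e a) \<longleftrightarrow> (\<exists>a' b. e a = e a' \<and> x = e b \<and> a' \<in> V \<and> b \<in> V \<and> adj a' b)"
      by (simp add: nbrs_def P_def)
    also have "\<dots> \<longleftrightarrow> (\<exists>b. x = e b \<and> b \<in> V \<and> adj a b)"
      using inj_onD[OF inj] that by blast
    finally show "x \<in> nbrs P (e a) \<longleftrightarrow> x \<in> e ` {b \<in> V. adj a b}" by blast
  qed
  have adj_sym: "adj b a" if "adj a b" for a b
    using that lG lH by (auto simp: adj_def nbrs_def lgraph_def split: prod.splits dest: symD)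
  have adj_irrefl: "\<not> adj a a" for a
    using lG by (auto simp: adj_def nbrs_def lgraph_def irrefl_def split: prod.splits)
  have symP: "sym (edges P)"
    using adj_sym unfolding sym_def P_def by simp blast
  have irreflP: "irrefl (edges P)"
    using adj_irrefl inj by (auto simp: irrefl_def P_def dest: inj_onD)
  have labP: "lab P (e a) = lab G (fst a)" "lab P (e a) = lab H (fst (snd a))" if "a \<in> V" for a
    using r that by (auto simp: P_def V_def bisim_lab)
  have "lgraph n P"
    unfolding lgraph_def
  proof (intro conjI symP irreflP)
    show "\<forall>v\<in>verts P. lab P v \<in> Rvec n \<and> (\<forall>i<n. lab P v i \<in> {0, 1})"
    proof
      fix v assume "v \<in> verts P"
      then obtain a where "a \<in> V" "v = e a" by (auto simp: P_def)
      then show "lab P v \<in> Rvec n \<and> (\<forall>i<n. lab P v i \<in> {0, 1})"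
        using labP(1)[of a] lG by (auto simp: V_def lgraph_def)
    qed
  qed (use finV in \<open>auto simp: P_def\<close>)
  moreover have "(u, w, 0) \<in> V"
    using assms by (auto simp: V_def pointed_graphs_def)
  ultimately have "(P, e (u, w, 0)) \<in> pointed_graphs n"
    by (auto simp: pointed_graphs_def P_def)
  moreover have "graded_cover l P (fst \<circ> r) (snd \<circ> snd \<circ> r) G"
    "graded_cover l P (fst \<circ> snd \<circ> r) (snd \<circ> snd \<circ> r) H"
  proof -
    \<comment> \<open>Below level \<open>l\<close> the remaining depth is a successor, so
      \<open>bisim\<close> unfolds once and supplies a matching neighbour in \<open>H\<close>, at
      the next level.\<close>
    have step: "\<exists>h' \<in> nbrs H h. (g', h', Suc i) \<in> V"
      if "(g, h, i) \<in> V" "i < l" "g' \<in> nbrs G g" for g h i g'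
    proof -
      have "l - i = Suc (l - Suc i)" using that(2) by simp
      then have "bisim (Suc (l - Suc i)) G g H h" using that(1) by (simp add: V_def)
      then show ?thesis
        using that lgraph_nbrs[OF lG, of g] lgraph_nbrs[OF lH, of h] by (fastforce simp: V_def)
    qed
    have step': "\<exists>g' \<in> nbrs G g. (g', h', Suc i) \<in> V"
      if "(g, h, i) \<in> V" "i < l" "h' \<in> nbrs H h" for g h i h'
    proof -
      have "l - i = Suc (l - Suc i)" using that(2) by simp
      then have "bisim (Suc (l - Suc i)) G g H h" using that(1) by (simp add: V_def)
      then show ?thesis
        using that lgraph_nbrs[OF lG, of g] lgraph_nbrs[OF lH, of h] by (fastforce simp: V_def)
    qed
    have vertsP: "verts P = e ` V" by (simp add: P_def)
    show "graded_cover l P (fst \<circ> r) (snd \<circ> snd \<circ> r) G"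
      unfolding graded_cover_def vertsP
    proof (intro conjI ballI impI; elim imageE; clarify)
      fix g h i v
      assume a: "(g, h, i) \<in> V" "(snd \<circ> snd \<circ> r) (e (g, h, i)) < l"
        "v \<in> nbrs G ((fst \<circ> r) (e (g, h, i)))"
      then obtain h' where "h' \<in> nbrs H h" "(v, h', Suc i) \<in> V"
        using step[of g h i v] r by auto
      with a show "\<exists>y\<in>nbrs P (e (g, h, i)). (fst \<circ> r) y = v"
        using r by (intro bexI[of _ "e (v, h', Suc i)"]) (auto simp: nbrsP adj_def)
    qed (auto simp: labP r nbrsP adj_def)
    show "graded_cover l P (fst \<circ> snd \<circ> r) (snd \<circ> snd \<circ> r) H"
      unfolding graded_cover_def vertsP
    proof (intro conjI ballI impI; elim imageE; clarify)
      fix g h i v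
      assume a: "(g, h, i) \<in> V" "(snd \<circ> snd \<circ> r) (e (g, h, i)) < l"
        "v \<in> nbrs H ((fst \<circ> snd \<circ> r) (e (g, h, i)))"
      then obtain g' where "g' \<in> nbrs G g" "(g', v, Suc i) \<in> V"
        using step'[of g h i v] r by auto
      with a show "\<exists>y\<in>nbrs P (e (g, h, i)). (fst \<circ> snd \<circ> r) y = v"
        using r by (intro bexI[of _ "e (g', v, Suc i)"]) (auto simp: nbrsP adj_def)
    qed (auto simp: labP(2) r nbrsP adj_def)
  qed
  ultimately show ?thesis
    using that[of P "e (u, w, 0)" "fst \<circ> r" "fst \<circ> snd \<circ> r" "snd \<circ> snd \<circ> r"] r \<open>(u, w, 0) \<in> V\<close>
    by simp
qed

section \<open>From networks to modal formulas\<close>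

lemma modal_expressible_of_key_invariant:
  fixes Q :: "'v::infinite pointed set"
  assumes "key_invariant_LocalMax_expressible n Q"
    and "key_invariant_LocalMax_expressible n (query_compl n Q)"
  shows "modal_expressible n Q"
proof -
  obtain A where A: "local_max A" "continuous_gnn A" "expressed_key_invariant n A Q"
    using assms(1) by (auto simp: key_invariant_LocalMax_expressible_def)
  obtain B where B: "local_max B" "continuous_gnn B"
    "expressed_key_invariant n B (query_compl n Q)"
    using assms(2) by (auto simp: key_invariant_LocalMax_expressible_def)
  have Q: "Q \<subseteq> pointed_graphs n"
    using A(3) by (auto simp: expressed_key_invariant_def key_query_def)
  \<comment> \<open>The common cover has to be deep enough for both networks at once.\<close>
  let ?l = "max (length A) (length B)"
  show ?thesis
  proof (rule modal_expressible_of_bisim_invariant[OF Q], rule ccontr)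
    fix G H :: "'v lgraph" and u w
    assume GQ: "(G, u) \<in> Q" and H: "(H, w) \<in> pointed_graphs n"
      and bis: "bisim ?l G u H w" and "(H, w) \<notin> Q"
    then have HQ: "(H, w) \<in> query_compl n Q" by (simp add: query_compl_def)
    obtain P :: "'v lgraph" and p \<pi> \<sigma> d where P: "(P, p) \<in> pointed_graphs n"
      "\<pi> p = u" "\<sigma> p = w" "d p = 0" "graded_cover ?l P \<pi> d G" "graded_cover ?l P \<sigma> d H"
      using bisim_common_cover[OF _ H bis] GQ Q by blast
    have "(P, p) \<in> Q"
      using key_query_graded_cover[OF A P(1) _ P(5)] GQ P by simp
    moreover have "(P, p) \<in> query_compl n Q"
      using key_query_graded_cover[OF B P(1) _ P(6)] HQ P by simp
    ultimately show False by (simp add: query_compl_def)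
  qed
qed

lemma modal_expressible_of_key_oblivious:
  fixes Q :: "'v pointed set"
  assumes "key_oblivious_ReLU_LocalMax_expressible n Q"
  shows "modal_expressible n Q"
proof -
  obtain A where A: "local_max A" "Q = oblivious_query n A"
    using assms by (auto simp: key_oblivious_ReLU_LocalMax_expressible_def expressed_key_oblivious_def)
  show ?thesis
  proof (rule modal_expressible_of_bisim_invariant)
    fix G H :: "'v lgraph" and u w
    assume "(G, u) \<in> Q" "(H, w) \<in> pointed_graphs n" "bisim (length A) G u H w"
    then show "(H, w) \<in> Q"
      using oblivious_output_bisim[OF A(1), of n G H u w]
      by (auto simp: A(2) oblivious_query_def pointed_graphs_def)
  qed (auto simp: A(2) oblivious_query_def)
qed


subsection \<open>Composition of networks\<close>

text \<open>Unlike \<open>wf_gnn\<close>, this allows any output dimension, so that networks can be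
  built by appending layers.\<close>

fun gnn_type :: "nat \<Rightarrow> gnn \<Rightarrow> nat \<Rightarrow> bool" where
  "gnn_type d [] e \<longleftrightarrow> d = e"
| "gnn_type d (L # A) e \<longleftrightarrow> din L = d \<and> wf_layer L \<and> gnn_type (dout L) A e"

lemma wf_gnn_iff_gnn_type: "wf_gnn d A \<longleftrightarrow> gnn_type d A 1"
  by (induction A arbitrary: d) auto

lemma gnn_type_snoc:
  "gnn_type d (A @ [L]) e \<longleftrightarrow> gnn_type d A (din L) \<and> wf_layer L \<and> dout L = e"
  by (induction A arbitrary: d) auto

lemma run_gnn_snoc: "run_gnn G (A @ [L]) emb = layer_step G L (run_gnn G A emb)"
  by (induction A arbitrary: emb) auto

definition max_layer :: "nat \<Rightarrow> nat \<Rightarrow> (vec \<Rightarrow> vec) \<Rightarrow> layer" where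
  "max_layer d e f = \<lparr>din = d, dout = e, agg = coord_max, com = f\<rparr>"

lemma max_layer_sel [simp]:
  "din (max_layer d e f) = d" "dout (max_layer d e f) = e"
  "agg (max_layer d e f) = coord_max" "com (max_layer d e f) = f"
  by (simp_all add: max_layer_def)

lemma relu_ffn_wf_max_layer: "relu_ffn (2 * d) e f \<Longrightarrow> wf_layer (max_layer d e f)"
  by (rule wf_layer_relu) simp_all

text \<open>Negate the output by one more layer. Since \<open>0\<close> is never output, rejection
  means a negative output, which becomes acceptance.\<close>

lemma nonzero_complement:
  fixes Q :: "'v pointed set"
  assumes "nonzero_key_invariant_LocalMax_expressible n Q"
  shows "key_invariant_LocalMax_expressible n (query_compl n Q)"
proof -
  obtain A where A: "local_max A" "continuous_gnn A" "wf_gnn (n + 1) A"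
    "key_invariant TYPE('v) n A" "Q = key_query n A" "never_zero TYPE('v) n A"
    using assms
    by (auto simp: nonzero_key_invariant_LocalMax_expressible_def expressed_key_invariant_def)
  \<comment> \<open>Input coordinate \<open>0\<close> is the node's own value, coordinate
    \<open>1\<close> the aggregate; only the former is read.\<close>
  define L where "L = max_layer 1 1 (affine_fun 2 1 (\<lambda>i j. if j = 0 then -1 else 0) (\<lambda>i. 0))"
  have ffn: "relu_ffn 2 1 (com L)"
    by (auto simp: L_def intro!: relu_ffn.affine)
  have out: "keyed_output n (A @ [L]) G key u = - keyed_output n A G key u"
    for G :: "'v lgraph" and key u
    by (simp add: keyed_output_def run_gnn_snoc layer_step_def L_def affine_fun_def vconcat_def
        numeral_2_eq_2)
  have nz: "keyed_output n A G key u \<noteq> 0"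
    if "(G, u) \<in> pointed_graphs n" "keyed_extension G key" for G :: "'v lgraph" and key u
    using A(6) that by (auto simp: never_zero_def)
  have inv: "(\<forall>key. keyed_extension G key \<longrightarrow> keyed_output n A G key u > 0) \<or>
        (\<forall>key. keyed_extension G key \<longrightarrow> keyed_output n A G key u < 0)"
    if "(G, u) \<in> pointed_graphs n" for G :: "'v lgraph" and u
    using A(4) nz that unfolding key_invariant_def
    by (smt (verit) case_prodD)
  \<comment> \<open>An injective key exists on every finite graph, so the universal condition in
    \<open>key_query\<close> is never vacuous.\<close>
  have ex: "\<exists>key. keyed_extension G key" if "(G, u) \<in> pointed_graphs n" for G :: "'v lgraph" and u
    using that exists_injective_key[of "verts G"]
    unfolding keyed_extension_def pointed_graphs_def lgraph_def by blast
  have compl_iff: "(\<exists>key. keyed_extension G key \<and> \<not> 0 < keyed_output n A G key u) \<longleftrightarrow>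
        (\<forall>key. keyed_extension G key \<longrightarrow> 0 < - keyed_output n A G key u)"
    if "(G, u) \<in> pointed_graphs n" for G :: "'v lgraph" and u
    using inv[OF that] ex[OF that] by (smt (verit))
  have "expressed_key_invariant n (A @ [L]) (query_compl n Q)"
    unfolding expressed_key_invariant_def
  proof (intro conjI)
    show "wf_gnn (n + 1) (A @ [L])"
      using A(3) ffn by (simp add: wf_gnn_iff_gnn_type gnn_type_snoc wf_layer_relu L_def)
    show "key_invariant TYPE('v) n (A @ [L])"
      using inv unfolding key_invariant_def out by fastforce
    show "query_compl n Q = key_query n (A @ [L])"
      unfolding query_compl_def A(5) key_query_def out
    proof (intro set_eqI, clarify)
      fix G :: "'v lgraph" and u
      show "(G, u) \<in> pointed_graphs n - {(G, u) \<in> pointed_graphs n.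
            \<forall>key. keyed_extension G key \<longrightarrow> 0 < keyed_output n A G key u} \<longleftrightarrow>
          (G, u) \<in> {(G, u) \<in> pointed_graphs n.
            \<forall>key. keyed_extension G key \<longrightarrow> 0 < - keyed_output n A G key u}"
        using compl_iff[of G u] by (cases "(G, u) \<in> pointed_graphs n") simp_all
    qed
  qed
  moreover have "local_max (A @ [L])" "continuous_gnn (A @ [L])"
    using A(1,2) relu_ffn_continuous[OF ffn]
    by (auto simp: local_max_def continuous_gnn_def L_def)
  ultimately show ?thesis
    by (auto simp: key_invariant_LocalMax_expressible_def)
qed


subsection \<open>Compilation of modal formulas\<close>

text \<open>The set \<open>I\<close> pairs graphs with their initial embeddings, so that keyed and
  unkeyed inputs are handled by the same compilation.\<close>

definition computes ::
    "nat \<Rightarrow> ('v lgraph \<times> ('v \<Rightarrow> vec)) set \<Rightarrow> gnn \<Rightarrow> nat fm list \<Rightarrow> bool" where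
  "computes d I A \<phi>s \<longleftrightarrow> gnn_type d A (length \<phi>s) \<and> local_max A \<and> relu_gnn A \<and>
     (\<forall>(G, emb)\<in>I. \<forall>v\<in>verts G. \<forall>i<length \<phi>s.
        run_gnn G A emb v i = of_bool (sat G v (\<phi>s ! i)))"

text \<open>The maximum of truth values is their disjunction; the default \<open>0\<close> for the
  empty maximum matches the falsity of a diamond at an isolated node.\<close>

lemma coord_max_of_bool:
  assumes "finite S" "\<And>v. v \<in> S \<Longrightarrow> emb v i = of_bool (P v)"
  shows "coord_max (image_mset emb (mset_set S)) i = of_bool (\<exists>v\<in>S. P v)"
proof -
  have "(\<lambda>v. emb v i) ` S = (\<lambda>v. of_bool (P v)) ` S" using assms(2) by (simp cong: image_cong)
  moreover have "Max ((\<lambda>v. of_bool (P v) :: real) ` S) = of_bool (\<exists>v\<in>S. P v)" if "S \<noteq> {}"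
    using assms(1) that by (intro Max_eqI) (auto simp: image_iff)
  ultimately show ?thesis using assms(1) by (simp add: coord_max_image_mset_set)
qed

text \<open>One layer keeps all earlier truth values and adds one neuron with weights
  \<open>w\<close> and bias \<open>c\<close>. Its inputs are the node's own truth values, followed
  by those of the corresponding diamonds.\<close>

lemma computes_snoc:
  fixes I :: "('v lgraph \<times> ('v \<Rightarrow> vec)) set" and w :: vec and c :: real
  assumes I: "\<forall>(G, emb)\<in>I. lgraph n G"
    and A: "computes d I A \<phi>s" and D: "D = length \<phi>s"
    and rat: "\<And>j. w j \<in> \<rat>" "c \<in> \<rat>"
    and val: "\<And>(G :: 'v lgraph) v x.
      \<lbrakk>\<And>j. j < D \<Longrightarrow> x j = of_bool (sat G v (\<phi>s ! j));
       \<And>j. j < D \<Longrightarrow> x (D + j) = of_bool (sat G v (Dia (\<phi>s ! j)))\<rbrakk> \<Longrightarrow>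
      max ((\<Sum>j<2 * D. w j * x j) + c) 0 = of_bool (sat G v \<psi>)"
  shows "\<exists>A'. computes d I A' (\<phi>s @ [\<psi>])"
proof -
  \<comment> \<open>The first \<open>D\<close> rows copy the old values, which \<open>relu\<close>
    preserves because they are \<open>0\<close> or \<open>1\<close>.\<close>
  define f where "f = relu \<circ> affine_fun (2 * D) (Suc D)
      (\<lambda>i j. if i < D then of_bool (i = j) else w j) (\<lambda>i. if i < D then 0 else c)"
  have ffn: "relu_ffn (2 * D) (Suc D) f"
    unfolding f_def using rat
    by (intro relu_ffn.comp[OF relu_ffn.affine relu_ffn.relu]) auto
  have f_low: "f x i = max (x i) 0" if "i < D" for x i
    using that by (simp add: f_def relu_def affine_fun_def of_bool_def if_distrib[of "\<lambda>a. a * _"]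
        cong: if_cong)
  have f_top: "f x D = max ((\<Sum>j<2 * D. w j * x j) + c) 0" for x
    by (simp add: f_def relu_def affine_fun_def)
  have "computes d I (A @ [max_layer D (Suc D) f]) (\<phi>s @ [\<psi>])"
    unfolding computes_def
  proof (intro conjI)
    show "gnn_type d (A @ [max_layer D (Suc D) f]) (length (\<phi>s @ [\<psi>]))"
      using A ffn D by (simp add: computes_def gnn_type_snoc relu_ffn_wf_max_layer)
    show "local_max (A @ [max_layer D (Suc D) f])" "relu_gnn (A @ [max_layer D (Suc D) f])"
      using A ffn by (auto simp: computes_def local_max_def relu_gnn_def)
    show "\<forall>(G, emb)\<in>I. \<forall>v\<in>verts G. \<forall>i<length (\<phi>s @ [\<psi>]).
        run_gnn G (A @ [max_layer D (Suc D) f]) emb v i = of_bool (sat G v ((\<phi>s @ [\<psi>]) ! i))"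
    proof (intro ballI allI impI, clarify)
      fix G :: "'v lgraph" and emb v i
      assume GI: "(G, emb) \<in> I" and v: "v \<in> verts G" and i: "i < length (\<phi>s @ [\<psi>])"
      define x where "x = vconcat D (run_gnn G A emb v)
          (coord_max (image_mset (run_gnn G A emb) (mset_set (nbrs G v))))"
      have lG: "lgraph n G" using I GI by auto
      have run: "run_gnn G A emb v j = of_bool (sat G v (\<phi>s ! j))" if "v \<in> verts G" "j < D" for v j
        using A GI that D by (auto simp: computes_def)
      have lo: "x j = of_bool (sat G v (\<phi>s ! j))" if "j < D" for j
        using run[OF v that] that by (simp add: x_def vconcat_def)
      have hi: "x (D + j) = of_bool (sat G v (Dia (\<phi>s ! j)))" if "j < D" for j
      proof -
        have "coord_max (image_mset (run_gnn G A emb) (mset_set (nbrs G v))) j =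
            of_bool (\<exists>v'\<in>nbrs G v. sat G v' (\<phi>s ! j))"
          using lgraph_nbrs[OF lG, of v] run that by (intro coord_max_of_bool) auto
        then show ?thesis by (simp add: x_def vconcat_def)
      qed
      have "run_gnn G (A @ [max_layer D (Suc D) f]) emb v i = f x i"
        by (simp add: run_gnn_snoc layer_step_def x_def)
      also have "\<dots> = of_bool (sat G v ((\<phi>s @ [\<psi>]) ! i))"
      proof (cases "i < D")
        case True
        then show ?thesis using lo D by (simp add: f_low nth_append)
      next
        case False
        then have "i = D" using i D by simp
        then show ?thesis using val[OF lo hi] D f_top[of x] by (simp add: nth_append)
      qed
      finally show "run_gnn G (A @ [max_layer D (Suc D) f]) emb v i =
          of_bool (sat G v ((\<phi>s @ [\<psi>]) ! i))" .
    qed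
  qed
  then show ?thesis by blast
qed

lemma sum_indicator_mult:
  fixes x :: "nat \<Rightarrow> real"
  assumes "a < m"
  shows "(\<Sum>j<m. of_bool (j = a) * x j) = x a"
  using assms by (simp add: of_bool_def if_distrib[of "\<lambda>a. a * _"] cong: if_cong)

text \<open>Induction on the formula, one layer per new connective. No earlier truth value is
  dropped, so the first conjunct remains available while the second is compiled.\<close>

lemma computes_extend:
  fixes I :: "('v lgraph \<times> ('v \<Rightarrow> vec)) set"
  assumes I: "\<forall>(G, emb)\<in>I. lgraph n G"
    and "computes d I A \<phi>s" "Prop ` props \<phi> \<subseteq> set \<phi>s"
  shows "\<exists>A' \<phi>s'. computes d I A' \<phi>s' \<and> set \<phi>s \<subseteq> set \<phi>s' \<and> \<phi> \<in> set \<phi>s'"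
  using assms(2,3)
proof (induction \<phi> arbitrary: A \<phi>s)
  case (Prop i)
  then show ?case by auto
next
  case Top
  have "\<exists>A'. computes d I A' (\<phi>s @ [Top])"
    by (rule computes_snoc[OF I Top(1) refl, where w = "\<lambda>_. 0" and c = 1]) (auto simp: max_def)
  then show ?case by (metis Un_iff UnI1 list.set_intros(1) set_append subsetI)
next
  case (And \<alpha> \<beta>)
  obtain A1 \<phi>s1 where 1: "computes d I A1 \<phi>s1" "set \<phi>s \<subseteq> set \<phi>s1" "\<alpha> \<in> set \<phi>s1"
    using And.IH(1)[OF And.prems(1)] And.prems(2) by auto
  obtain A2 \<phi>s2 where 2: "computes d I A2 \<phi>s2" "set \<phi>s1 \<subseteq> set \<phi>s2" "\<beta> \<in> set \<phi>s2"
    using And.IH(2)[OF 1(1)] And.prems(2) 1(2) by auto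
  obtain a b where ab: "a < length \<phi>s2" "\<phi>s2 ! a = \<alpha>" "b < length \<phi>s2" "\<phi>s2 ! b = \<beta>"
    using 1(3) 2(2,3) by (metis in_set_conv_nth subsetD)
  \<comment> \<open>Conjunction is \<open>max (x a + x b - 1) 0\<close>. Adding two indicators also
    covers \<open>a = b\<close>, where the weight becomes \<open>2\<close>.\<close>
  have "\<exists>A'. computes d I A' (\<phi>s2 @ [And \<alpha> \<beta>])"
  proof (rule computes_snoc[OF I 2(1) refl, where c = "-1"
        and w = "\<lambda>j. of_bool (j = a) + of_bool (j = b)"])
    fix G :: "'v lgraph" and v and x :: vec
    assume "\<And>j. j < length \<phi>s2 \<Longrightarrow> x j = of_bool (sat G v (\<phi>s2 ! j))"
    then have "x a = of_bool (sat G v \<alpha>)" "x b = of_bool (sat G v \<beta>)" using ab by auto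
    moreover have "(\<Sum>j<2 * length \<phi>s2. (of_bool (j = a) + of_bool (j = b)) * x j) = x a + x b"
      using ab by (simp only: distrib_right sum.distrib) (simp add: sum_indicator_mult)
    ultimately show "max ((\<Sum>j<2 * length \<phi>s2. (of_bool (j = a) + of_bool (j = b)) * x j) + - 1) 0
        = of_bool (sat G v (And \<alpha> \<beta>))"
      by simp
  qed auto
  then obtain A' where "computes d I A' (\<phi>s2 @ [And \<alpha> \<beta>])" by blast
  with 1(2) 2(2) show ?case by (intro exI[of _ A'] exI[of _ "\<phi>s2 @ [And \<alpha> \<beta>]"]) auto
next
  case (Neg \<alpha>)
  obtain A1 \<phi>s1 where 1: "computes d I A1 \<phi>s1" "set \<phi>s \<subseteq> set \<phi>s1" "\<alpha> \<in> set \<phi>s1"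
    using Neg.IH[OF Neg.prems(1)] Neg.prems(2) by auto
  obtain a where a: "a < length \<phi>s1" "\<phi>s1 ! a = \<alpha>"
    using 1(3) by (metis in_set_conv_nth)
  have "\<exists>A'. computes d I A' (\<phi>s1 @ [Neg \<alpha>])"
  proof (rule computes_snoc[OF I 1(1) refl, where c = 1 and w = "\<lambda>j. - of_bool (j = a)"])
    fix G :: "'v lgraph" and v and x :: vec
    assume "\<And>j. j < length \<phi>s1 \<Longrightarrow> x j = of_bool (sat G v (\<phi>s1 ! j))"
    then have "x a = of_bool (sat G v \<alpha>)" using a by auto
    then show "max ((\<Sum>j<2 * length \<phi>s1. - of_bool (j = a) * x j) + 1) 0 = of_bool (sat G v (Neg \<alpha>))"
      using a by (simp add: sum_negf sum_indicator_mult)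
  qed auto
  then obtain A' where "computes d I A' (\<phi>s1 @ [Neg \<alpha>])" by blast
  with 1(2) show ?case by (intro exI[of _ A'] exI[of _ "\<phi>s1 @ [Neg \<alpha>]"]) auto
next
  case (Dia \<alpha>)
  obtain A1 \<phi>s1 where 1: "computes d I A1 \<phi>s1" "set \<phi>s \<subseteq> set \<phi>s1" "\<alpha> \<in> set \<phi>s1"
    using Dia.IH[OF Dia.prems(1)] Dia.prems(2) by auto
  obtain a where a: "a < length \<phi>s1" "\<phi>s1 ! a = \<alpha>"
    using 1(3) by (metis in_set_conv_nth)
  \<comment> \<open>The offset \<open>length \<phi>s1\<close> selects the aggregated half of the
    input, which already holds the diamond.\<close>
  have "\<exists>A'. computes d I A' (\<phi>s1 @ [Dia \<alpha>])"
  proof (rule computes_snoc[OF I 1(1) refl, where c = 0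
        and w = "\<lambda>j. of_bool (j = length \<phi>s1 + a)"])
    fix G :: "'v lgraph" and v and x :: vec
    assume "\<And>j. j < length \<phi>s1 \<Longrightarrow> x (length \<phi>s1 + j) = of_bool (sat G v (Dia (\<phi>s1 ! j)))"
    then have "x (length \<phi>s1 + a) = of_bool (sat G v (Dia \<alpha>))" using a by auto
    then show "max ((\<Sum>j<2 * length \<phi>s1. of_bool (j = length \<phi>s1 + a) * x j) + 0) 0 =
        of_bool (sat G v (Dia \<alpha>))"
      using a by (subst sum_indicator_mult) auto
  qed auto
  then obtain A' where "computes d I A' (\<phi>s1 @ [Dia \<alpha>])" by blast
  with 1(2) show ?case by (intro exI[of _ A'] exI[of _ "\<phi>s1 @ [Dia \<alpha>]"]) auto
qed

lemma modal_formula_gnn: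
  fixes I :: "('v lgraph \<times> ('v \<Rightarrow> vec)) set"
  assumes I: "\<forall>(G, emb)\<in>I. lgraph n G"
    and "computes d I A0 (map Prop [0..<n])" "props \<phi> \<subseteq> {..<n}"
  obtains A where "wf_gnn d A" "local_max A" "relu_gnn A"
    "\<And>G emb v. \<lbrakk>(G, emb) \<in> I; v \<in> verts G\<rbrakk> \<Longrightarrow>
       run_gnn G A emb v 0 = (if sat G v \<phi> then 1 else -1)"
proof -
  have "Prop ` props \<phi> \<subseteq> set (map Prop [0..<n])" using assms(3) by auto
  from computes_extend[OF I assms(2) this]
  obtain A \<phi>s where A: "computes d I A \<phi>s" "\<phi> \<in> set \<phi>s" by auto
  then obtain a where a: "a < length \<phi>s" "\<phi>s ! a = \<phi>" by (metis in_set_conv_nth)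
  let ?D = "length \<phi>s"
  \<comment> \<open>The final layer sends truth values \<open>0\<close> and \<open>1\<close> to
    \<open>-1\<close> and \<open>1\<close>, so that the sign decides acceptance and \<open>0\<close>
    is avoided.\<close>
  define f where "f = affine_fun (2 * ?D) 1 (\<lambda>i j. 2 * of_bool (j = a)) (\<lambda>i. -1)"
  have ffn: "relu_ffn (2 * ?D) 1 f"
    unfolding f_def by (intro relu_ffn.affine) auto
  have f: "f x 0 = 2 * x a - 1" for x
  proof -
    have "(\<Sum>j<2 * ?D. 2 * of_bool (j = a) * x j) = 2 * (\<Sum>j<2 * ?D. of_bool (j = a) * x j)"
      by (simp only: sum_distrib_left mult.assoc)
    then show ?thesis using a by (simp add: f_def affine_fun_def sum_indicator_mult)
  qed
  let ?A = "A @ [max_layer ?D 1 f]"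
  show ?thesis
  proof (rule that[of ?A])
    show "wf_gnn d ?A"
      using A(1) ffn by (simp add: computes_def wf_gnn_iff_gnn_type gnn_type_snoc relu_ffn_wf_max_layer)
    show "local_max ?A" "relu_gnn ?A"
      using A(1) ffn by (auto simp: computes_def local_max_def relu_gnn_def)
    fix G :: "'v lgraph" and emb v
    assume "(G, emb) \<in> I" "v \<in> verts G"
    then have "run_gnn G A emb v a = of_bool (sat G v \<phi>)"
      using A(1) a by (auto simp: computes_def)
    then show "run_gnn G ?A emb v 0 = (if sat G v \<phi> then 1 else -1)"
      using a by (simp add: run_gnn_snoc layer_step_def f vconcat_def)
  qed
qed

section \<open>From modal formulas to networks, and the equivalences\<close>

lemma lab_eq_0: "\<lbrakk>lgraph n G; v \<in> verts G; i < n; lab G v i \<noteq> 1\<rbrakk> \<Longrightarrow> lab G v i = 0"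
  by (auto simp: lgraph_def)

lemma key_oblivious_of_modal_expressible:
  fixes Q :: "'v pointed set"
  assumes "modal_expressible n Q"
  shows "key_oblivious_ReLU_LocalMax_expressible n Q"
proof -
  obtain \<phi> where \<phi>: "props \<phi> \<subseteq> {..<n}" "Q = {(G, u) \<in> pointed_graphs n. sat G u \<phi>}"
    using assms by (auto simp: modal_expressible_def)
  define I where "I = {(G :: 'v lgraph, lab G) | G. lgraph n G}"
  \<comment> \<open>The labels are already the truth values of the propositions, so compilation
    starts from the empty network.\<close>
  have "computes n I [] (map Prop [0..<n])"
    by (auto simp: computes_def I_def local_max_def relu_gnn_def intro: lab_eq_0)
  then obtain A where A: "wf_gnn n A" "local_max A" "relu_gnn A"
    "\<And>G emb v. \<lbrakk>(G, emb) \<in> I; v \<in> verts G\<rbrakk> \<Longrightarrow>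
       run_gnn G A emb v 0 = (if sat G v \<phi> then 1 else -1)"
    using modal_formula_gnn[OF _ _ \<phi>(1), of I n] by (auto simp: I_def)
  have "oblivious_output A G u > 0 \<longleftrightarrow> sat G u \<phi>" if "(G, u) \<in> pointed_graphs n" for G :: "'v lgraph" and u
    using A(4)[of G "lab G" u] that by (auto simp: oblivious_output_def I_def pointed_graphs_def)
  then have "Q = oblivious_query n A"
    by (auto simp: \<phi>(2) oblivious_query_def)
  with A show ?thesis
    by (auto simp: key_oblivious_ReLU_LocalMax_expressible_def expressed_key_oblivious_def)
qed

lemma nonzero_key_invariant_of_modal_expressible:
  fixes Q :: "'v pointed set"
  assumes "modal_expressible n Q"
  shows "nonzero_key_invariant_LocalMax_expressible n Q"
proof -
  obtain \<phi> where \<phi>: "props \<phi> \<subseteq> {..<n}" "Q = {(G, u) \<in> pointed_graphs n. sat G u \<phi>}"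
    using assms by (auto simp: modal_expressible_def)
  define init where
    "init = (\<lambda>(G :: 'v lgraph) (key :: 'v \<Rightarrow> real) v. vconcat n (lab G v) (vsingle (key v)))"
  define I where "I = {(G, init G key) | G key. lgraph n G}"
  \<comment> \<open>An initial projection to the first \<open>n\<close> coordinates discards the
    key, stored at index \<open>n\<close>, and the aggregate.\<close>
  define f where "f = affine_fun (2 * (n + 1)) n (\<lambda>i j. of_bool (j = i)) (\<lambda>i. 0)"
  have ffn: "relu_ffn (2 * (n + 1)) n f"
    unfolding f_def by (intro relu_ffn.affine) auto
  have f: "f x i = x i" if "i < n" for x i
    using that by (simp add: f_def affine_fun_def sum_indicator_mult del: sum.lessThan_Suc)
  have "computes (n + 1) I [max_layer (n + 1) n f] (map Prop [0..<n])"
    unfolding computes_def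
  proof (intro conjI)
    show "gnn_type (n + 1) [max_layer (n + 1) n f] (length (map Prop [0..<n]))"
      using relu_ffn_wf_max_layer[OF ffn] by simp
    show "local_max [max_layer (n + 1) n f]" "relu_gnn [max_layer (n + 1) n f]"
      using ffn by (simp_all add: local_max_def relu_gnn_def)
    show "\<forall>(G, emb)\<in>I. \<forall>v\<in>verts G. \<forall>i<length (map Prop [0..<n]).
        run_gnn G [max_layer (n + 1) n f] emb v i = of_bool (sat G v (map Prop [0..<n] ! i))"
      by (auto simp: I_def init_def layer_step_def f vconcat_def intro: lab_eq_0)
  qed
  then obtain A where A: "wf_gnn (n + 1) A" "local_max A" "relu_gnn A"
    "\<And>G emb v. \<lbrakk>(G, emb) \<in> I; v \<in> verts G\<rbrakk> \<Longrightarrow>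
       run_gnn G A emb v 0 = (if sat G v \<phi> then 1 else -1)"
    using modal_formula_gnn[OF _ _ \<phi>(1), of I "n + 1"] by (auto simp: I_def)
  have out: "keyed_output n A G key u = (if sat G u \<phi> then 1 else -1)"
    if "(G, u) \<in> pointed_graphs n" for G :: "'v lgraph" and u key
  proof -
    have "(G, init G key) \<in> I" "u \<in> verts G"
      using that by (auto simp: I_def pointed_graphs_def)
    from A(4)[OF this] show ?thesis by (simp add: keyed_output_def init_def)
  qed
  have ex: "\<exists>key. keyed_extension G key" if "(G, u) \<in> pointed_graphs n" for G :: "'v lgraph" and u
    using that exists_injective_key[of "verts G"]
    unfolding keyed_extension_def pointed_graphs_def lgraph_def by blast
  have "Q = key_query n A"
    using ex by (auto simp: \<phi>(2) key_query_def out split: if_splits)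
  moreover have "key_invariant TYPE('v) n A" "never_zero TYPE('v) n A"
    by (auto simp: key_invariant_def never_zero_def out split: if_splits)
  ultimately show ?thesis
    using A relu_gnn_continuous
    by (auto simp: nonzero_key_invariant_LocalMax_expressible_def expressed_key_invariant_def)
qed

theorem theorem4p5:
  fixes n :: nat and Q :: "'v::infinite pointed set"
  assumes "node_query n Q"
  shows "(nonzero_key_invariant_LocalMax_expressible n Q \<longleftrightarrow>
            key_invariant_LocalMax_expressible n Q \<and>
            key_invariant_LocalMax_expressible n (query_compl n Q)) \<and>
         (key_invariant_LocalMax_expressible n Q \<and>
            key_invariant_LocalMax_expressible n (query_compl n Q) \<longleftrightarrow>
            key_oblivious_ReLU_LocalMax_expressible n Q) \<and>
         (key_oblivious_ReLU_LocalMax_expressible n Q \<longleftrightarrow> modal_expressible n Q)"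
proof -
  have "nonzero_key_invariant_LocalMax_expressible n Q \<Longrightarrow> key_invariant_LocalMax_expressible n Q"
    by (auto simp: nonzero_key_invariant_LocalMax_expressible_def
        key_invariant_LocalMax_expressible_def)
  \<comment> \<open>The first, second and fourth conditions imply each other in a cycle, and the
    third is equivalent to the fourth.\<close>
  then show ?thesis
    using nonzero_complement[of n Q] modal_expressible_of_key_invariant[of n Q]
      modal_expressible_of_key_oblivious[of n Q] key_oblivious_of_modal_expressible[of n Q]
      nonzero_key_invariant_of_modal_expressible[of n Q]
    by blast
qed

end
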